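(* Let $\mathcal{A}=\langle S,s^0,L,\Delta\rangle$ be a probabilistic automaton and let $c\subseteq\{(s,a,\mu)\in\Delta\mid a=\tau,\ \mu\text{ is deterministic}\}$ be a weakly probabilistically confluent set of its $\tau$-transitions. Then the quotient automaton $\mathcal{A}/{\leftrightarrow_c^*}$ and $\mathcal{A}$ are branching probabilistically bisimilar.
   Context: Distributions. $\mathrm{Distr}(S)$ is the set of probability distributions $\mu:S\to[0,1]$, $\sum_{s\in S}\mu(s)=1$, on a countable set $S$. $\mathbb{1}_t$ is the deterministic distribution with $\mathbb{1}_t(t)=1$. For an equivalence relation $R$ on $S$, $\mu\equiv_R\mu'$ means $\mu(C)=\mu'(C)$ for all $C\in S/R$, where $\mu(C)=\sum_{s\in C}\mu(s)$. Probabilistic automata. A probabilistic automaton (PA) is a tuple $\langle S,s^0,L,\Delta\rangle$ with $S$ a countable set of states, $s^0\in S$ initial, $L$ a countable set of actions containing the unobservable action $\tau$, and $\Delta\subseteq S\times L\times\mathrm{Distr}(S)$ a countable transition relation. Write $s\xrightarrow{a}\mu$ for $(s,a,\mu)\in\Delta$, and $s\xrightarrow{a}t$ for $s\xrightarrow{a}\mathbb{1}_t$. Paths and schedulers. A finite path is a sequence $\pi=s_0\,(a_1,\mu_1)\,s_1\,(a_2,\mu_2)\cdots(a_n,\mu_n)\,s_n$ ($n\ge 0$) with $s_{i}\xrightarrow{a_{i+1}}\mu_{i+1}$ and $\mu_{i+1}(s_{i+1})>0$; $\mathrm{last}(\pi)=s_n$. A scheduler $\mathcal{S}$ assigns to every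 finite path $\pi$ a probability distribution over $\{\bot\}\cup\Delta$, giving positive probability only to $\bot$ and to transitions $(s,a,\mu)$ with $s=\mathrm{last}(\pi)$ ($\bot$ means stopping). The probability of $\pi$ from $s$ is defined by $P_s^{\mathcal{S}}(s)=1$, $P_s^{\mathcal{S}}(\pi\,(a,\mu)\,t)=P_s^{\mathcal{S}}(\pi)\cdot\mathcal{S}(\pi)(\mathrm{last}(\pi),a,\mu)\cdot\mu(t)$. A maximal path of $\mathcal{S}$ from $s$ is a finite path from $s$ all of whose transitions are scheduled with positive probability after the corresponding prefix and with $\mathcal{S}(\pi)(\bot)>0$. The final state (sub)distribution is $F^{\mathcal{S}}(s)(s')=\sum_{\pi}P_s^{\mathcal{S}}(\pi)\cdot\mathcal{S}(\pi)(\bot)$, over maximal paths $\pi$ of $\mathcal{S}$ from $s$ with $\mathrm{last}(\pi)=s'$. Branching steps. For an equivalence relation $R$ on $S$, $s\Rightarrow^a_R\mu$ if either (1) $a=\tau$ and $\mu=\mathbb{1}_s$, or (2) there is a scheduler $\mathcal{S}$ with $F^{\mathcal{S}}(s)=\mu$ such that every maximal path $s\,(a_1,\mu_1)\,s_1\cdots(a_n,\mu_n)\,s_n$ of $\mathcal{S}$ from $s$ satisfies $a_n=a$ (in particular $n\ge1$) and $a_i=\tau$, $(s,s_i)\in R$ for all $1\le i<n$. Bisimulation. An equivalence relation $R\subseteq S\times S$ is a branching probabilistic bisimulation if for all $(s,t)\in R$: $s\xrightarrow{a}\mu$ implies $\exists\mu'\in\mathrm{Distr}(S)$ with $t\Rightarrow^a_R\mu'$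 and $\mu\equiv_R\mu'$. States $p,q$ are branching probabilistically bisimilar if $(p,q)\in R$ for some branching probabilistic bisimulation $R$. Two PAs are branching probabilistically bisimilar if their initial states are so in the disjoint union of the two PAs. Confluence. Let $c$ be a set of $\tau$-transitions with deterministic distributions. Write $s\to_c t$ if $(s,\tau,\mathbb{1}_t)\in c$; $s\twoheadrightarrow_c t$ if there is a finite (possibly empty) path of $\to_c$-steps from $s$ to $t$; $s\leftrightarrow_c^* t$ if $s$ and $t$ are connected by finitely many (possibly zero) $\to_c$-steps, each of which may be traversed in either direction (this is an equivalence relation). Let $R_c=\{(s,s')\mid\exists u:\ s\twoheadrightarrow_c u\text{ and }s'\twoheadrightarrow_c u\}$. The set $c$ is weakly probabilistically confluent if $R_c$ is an equivalence relation and, for every path $s\twoheadrightarrow_c t$ and all $a\in L$, $\mu\in\mathrm{Distr}(S)$: $s\xrightarrow{a}\mu$ implies that there is $t'\in S$ with $t\twoheadrightarrow_c t'$ and [($\exists\nu\in\mathrm{Distr}(S)$: $t'\xrightarrow{a}\nu$ and $\mu\equiv_{R_c}\nu$) or ($a=\tau$ and $\mu\equiv_{R_c}\mathbb{1}_{t'}$)]. Quotient. For an equivalence relation $R$ on $S$, $\mathcal{A}/R=\langle S/R,[s^0]_R,L,\Delta_R\rangle$, where $\Delta_R\subseteq S/R\times L\times\mathrm{Distr}(S/R)$ contains $([s]_R,a,\mu)$ if and only if there exist $s'\in[s]_R$ and $\mu'$ with $s'\xrightarrow{a}\mu'$ in $\mathcal{A}$ and $\mu([t]_R)=\sum_{t'\in[t]_R}\mu'(t')$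 for all $[t]_R\in S/R$. *)

theory Defs
  imports "HOL-Probability.Probability"
begin

text \<open>
  Distributions over a countable set \<open>S\<close> are the probability mass functions with support in
  \<open>S\<close>. Relations live on the carrier set \<open>S\<close>, not on the whole type.
\<close>

definition Distr :: "'s set \<Rightarrow> 's pmf set" where
  "Distr S = {\<mu>. set_pmf \<mu> \<subseteq> S}"

definition distr_equiv :: "'s set \<Rightarrow> ('s \<times> 's) set \<Rightarrow> 's pmf \<Rightarrow> 's pmf \<Rightarrow> bool" where
  "distr_equiv S R \<mu> \<mu>' \<longleftrightarrow>
     (\<forall>C \<in> S // R. measure_pmf.prob \<mu> C = measure_pmf.prob \<mu>' C)"


section \<open>Probabilistic automata\<close>

text \<open>
  The unobservable action is not a component of the automaton: it is a parameter \<open>\<tau>\<close> that is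
  shared by all automata that are compared with each other.
\<close>

record ('s, 'l) pa =
  states :: "'s set"
  init :: 's
  actions :: "'l set"
  transitions :: "('s \<times> 'l \<times> 's pmf) set"

definition prob_automaton :: "'l \<Rightarrow> ('s, 'l) pa \<Rightarrow> bool" where
  "prob_automaton \<tau> A \<longleftrightarrow>
     countable (states A) \<and> init A \<in> states A \<and>
     countable (actions A) \<and> \<tau> \<in> actions A \<and>
     transitions A \<subseteq> states A \<times> actions A \<times> Distr (states A) \<and>
     countable (transitions A)"


section \<open>Paths and schedulers\<close>

text \<open>\<open>Step \<pi> a \<mu> t\<close> is the path \<open>\<pi>\<close> extended at its end by \<open>(a, \<mu>) t\<close>.\<close>

datatype ('s, 'l) path = Init 's | Step "('s, 'l) path" 'l "'s pmf" 's

primrec first_state :: "('s, 'l) path \<Rightarrow> 's" where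
  "first_state (Init s) = s"
| "first_state (Step \<pi> a \<mu> t) = first_state \<pi>"

primrec last_state :: "('s, 'l) path \<Rightarrow> 's" where
  "last_state (Init s) = s"
| "last_state (Step \<pi> a \<mu> t) = t"

primrec finite_path :: "('s, 'l) pa \<Rightarrow> ('s, 'l) path \<Rightarrow> bool" where
  "finite_path A (Init s) \<longleftrightarrow> s \<in> states A"
| "finite_path A (Step \<pi> a \<mu> t) \<longleftrightarrow>
     finite_path A \<pi> \<and> (last_state \<pi>, a, \<mu>) \<in> transitions A \<and> pmf \<mu> t > 0"

text \<open>\<open>None\<close> plays the role of \<open>\<bottom>\<close>, i.e. of stopping.\<close>

type_synonym ('s, 'l) scheduler = "('s, 'l) path \<Rightarrow> ('s \<times> 'l \<times> 's pmf) option pmf"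

definition is_scheduler :: "('s, 'l) pa \<Rightarrow> ('s, 'l) scheduler \<Rightarrow> bool" where
  "is_scheduler A \<S> \<longleftrightarrow>
     (\<forall>\<pi>. finite_path A \<pi> \<longrightarrow>
        set_pmf (\<S> \<pi>) \<subseteq>
          {None} \<union> Some ` {(s, a, \<mu>). (s, a, \<mu>) \<in> transitions A \<and> s = last_state \<pi>})"

text \<open>The probability of a path from its own first state.\<close>

primrec path_prob :: "('s, 'l) scheduler \<Rightarrow> ('s, 'l) path \<Rightarrow> real" where
  "path_prob \<S> (Init s) = 1"
| "path_prob \<S> (Step \<pi> a \<mu> t) =
     path_prob \<S> \<pi> * pmf (\<S> \<pi>) (Some (last_state \<pi>, a, \<mu>)) * pmf \<mu> t"

primrec scheduled :: "('s, 'l) scheduler \<Rightarrow> ('s, 'l) path \<Rightarrow> bool" where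
  "scheduled \<S> (Init s) \<longleftrightarrow> True"
| "scheduled \<S> (Step \<pi> a \<mu> t) \<longleftrightarrow>
     scheduled \<S> \<pi> \<and> pmf (\<S> \<pi>) (Some (last_state \<pi>, a, \<mu>)) > 0"

definition maximal_paths ::
    "('s, 'l) pa \<Rightarrow> ('s, 'l) scheduler \<Rightarrow> 's \<Rightarrow> ('s, 'l) path set" where
  "maximal_paths A \<S> s =
     {\<pi>. finite_path A \<pi> \<and> first_state \<pi> = s \<and> scheduled \<S> \<pi> \<and> pmf (\<S> \<pi>) None > 0}"

text \<open>
  The sum may be infinite; it is taken in the extended non-negative reals, where it always
  exists.
\<close>

definition final_distr ::
    "('s, 'l) pa \<Rightarrow> ('s, 'l) scheduler \<Rightarrow> 's \<Rightarrow> 's \<Rightarrow> ennreal" where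
  "final_distr A \<S> s s' =
     (\<Sum>\<^sub>\<infinity>\<pi> \<in> {\<pi> \<in> maximal_paths A \<S> s. last_state \<pi> = s'}.
        ennreal (path_prob \<S> \<pi> * pmf (\<S> \<pi>) None))"


section \<open>Branching probabilistic bisimulation\<close>

text \<open>
  All steps of the path are \<open>\<tau>\<close>-steps to states related to \<open>s\<close>. In a branching step this is
  required of all steps but the last one.
\<close>

primrec silent_within :: "'l \<Rightarrow> ('s \<times> 's) set \<Rightarrow> 's \<Rightarrow> ('s, 'l) path \<Rightarrow> bool" where
  "silent_within \<tau> R s (Init t) \<longleftrightarrow> True"
| "silent_within \<tau> R s (Step \<pi> a \<mu> t) \<longleftrightarrow> silent_within \<tau> R s \<pi> \<and> a = \<tau> \<and> (s, t) \<in> R"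

definition branching_step ::
    "'l \<Rightarrow> ('s, 'l) pa \<Rightarrow> ('s \<times> 's) set \<Rightarrow> 's \<Rightarrow> 'l \<Rightarrow> 's pmf \<Rightarrow> bool" where
  "branching_step \<tau> A R s a \<mu> \<longleftrightarrow>
     (a = \<tau> \<and> \<mu> = return_pmf s) \<or>
     (\<exists>\<S>. is_scheduler A \<S> \<and>
        (\<forall>s' \<in> states A. final_distr A \<S> s s' = ennreal (pmf \<mu> s')) \<and>
        (\<forall>\<pi> \<in> maximal_paths A \<S> s.
           \<exists>\<pi>' \<nu> t. \<pi> = Step \<pi>' a \<nu> t \<and> silent_within \<tau> R s \<pi>'))"

definition branching_bisimulation ::
    "'l \<Rightarrow> ('s, 'l) pa \<Rightarrow> ('s \<times> 's) set \<Rightarrow> bool" where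
  "branching_bisimulation \<tau> A R \<longleftrightarrow>
     equiv (states A) R \<and>
     (\<forall>(s, t) \<in> R. \<forall>a \<mu>. (s, a, \<mu>) \<in> transitions A \<longrightarrow>
        (\<exists>\<mu>' \<in> Distr (states A).
           branching_step \<tau> A R t a \<mu>' \<and> distr_equiv (states A) R \<mu> \<mu>'))"

definition bisimilar_states :: "'l \<Rightarrow> ('s, 'l) pa \<Rightarrow> 's \<Rightarrow> 's \<Rightarrow> bool" where
  "bisimilar_states \<tau> A p q \<longleftrightarrow> (\<exists>R. branching_bisimulation \<tau> A R \<and> (p, q) \<in> R)"

text \<open>
  The initial state of a disjoint union is irrelevant for bisimilarity of states; we choose
  the one of the left automaton.
\<close>

definition pa_sum :: "('s, 'l) pa \<Rightarrow> ('t, 'l) pa \<Rightarrow> ('s + 't, 'l) pa" where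
  "pa_sum A B =
     \<lparr> states = states A <+> states B,
       init = Inl (init A),
       actions = actions A \<union> actions B,
       transitions =
         {(Inl s, a, map_pmf Inl \<mu>) | s a \<mu>. (s, a, \<mu>) \<in> transitions A} \<union>
         {(Inr s, a, map_pmf Inr \<mu>) | s a \<mu>. (s, a, \<mu>) \<in> transitions B} \<rparr>"

definition bisimilar :: "'l \<Rightarrow> ('s, 'l) pa \<Rightarrow> ('t, 'l) pa \<Rightarrow> bool" where
  "bisimilar \<tau> A B \<longleftrightarrow> bisimilar_states \<tau> (pa_sum A B) (Inl (init A)) (Inr (init B))"


section \<open>Confluence\<close>

text \<open>
  The reflexive-transitive closures are restricted to the state set, because \<open>rtrancl\<close> is
  reflexive on the whole type.
\<close>

definition conf_step :: "'l \<Rightarrow> ('s \<times> 'l \<times> 's pmf) set \<Rightarrow> ('s \<times> 's) set" where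
  "conf_step \<tau> c = {(s, t). (s, \<tau>, return_pmf t) \<in> c}"

definition conf_reach ::
    "'l \<Rightarrow> ('s, 'l) pa \<Rightarrow> ('s \<times> 'l \<times> 's pmf) set \<Rightarrow> ('s \<times> 's) set" where
  "conf_reach \<tau> A c = (conf_step \<tau> c)\<^sup>* \<inter> states A \<times> states A"

definition conf_conv ::
    "'l \<Rightarrow> ('s, 'l) pa \<Rightarrow> ('s \<times> 'l \<times> 's pmf) set \<Rightarrow> ('s \<times> 's) set" where
  "conf_conv \<tau> A c = (conf_step \<tau> c \<union> (conf_step \<tau> c)\<inverse>)\<^sup>* \<inter> states A \<times> states A"

definition conf_join ::
    "'l \<Rightarrow> ('s, 'l) pa \<Rightarrow> ('s \<times> 'l \<times> 's pmf) set \<Rightarrow> ('s \<times> 's) set" where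
  "conf_join \<tau> A c =
     {(s, s'). \<exists>u. (s, u) \<in> conf_reach \<tau> A c \<and> (s', u) \<in> conf_reach \<tau> A c}"

definition weakly_confluent ::
    "'l \<Rightarrow> ('s, 'l) pa \<Rightarrow> ('s \<times> 'l \<times> 's pmf) set \<Rightarrow> bool" where
  "weakly_confluent \<tau> A c \<longleftrightarrow>
     equiv (states A) (conf_join \<tau> A c) \<and>
     (\<forall>(s, t) \<in> conf_reach \<tau> A c. \<forall>a \<in> actions A. \<forall>\<mu> \<in> Distr (states A).
        (s, a, \<mu>) \<in> transitions A \<longrightarrow>
        (\<exists>t' \<in> states A. (t, t') \<in> conf_reach \<tau> A c \<and>
           ((\<exists>\<nu> \<in> Distr (states A). (t', a, \<nu>) \<in> transitions A \<and>
               distr_equiv (states A) (conf_join \<tau> A c) \<mu> \<nu>) \<or>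
            (a = \<tau> \<and> distr_equiv (states A) (conf_join \<tau> A c) \<mu> (return_pmf t')))))"


section \<open>Quotients\<close>

definition quotient_pa :: "('s, 'l) pa \<Rightarrow> ('s \<times> 's) set \<Rightarrow> ('s set, 'l) pa" where
  "quotient_pa A R =
     \<lparr> states = states A // R,
       init = R `` {init A},
       actions = actions A,
       transitions =
         {(C, a, \<mu>). C \<in> states A // R \<and> a \<in> actions A \<and> \<mu> \<in> Distr (states A // R) \<and>
            (\<exists>s' \<in> C. \<exists>\<mu>'. (s', a, \<mu>') \<in> transitions A \<and>
               (\<forall>D \<in> states A // R. pmf \<mu> D = measure_pmf.prob \<mu>' D))} \<rparr>"

end

theory Submission
  imports Defs
begin

text \<open>
  Relate states of the disjoint union of \<open>A/\<leftrightarrow>\<^sub>c\<^sup>*\<close> and \<open>A\<close> when they determine the same class.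
  Every transition of the quotient comes from a transition of \<open>A\<close> with the same image
  distribution on classes, so it suffices to simulate transitions of \<open>A\<close>: the quotient does so
  in one step. If \<open>s\<close> and \<open>t\<close> lie in the same class, they have a common
  confluent descendant \<open>u\<close>, and weak confluence along \<open>s \<rightarrow>\<^sub>c\<^sup>* u\<close> lets some confluent
  descendant \<open>t'\<close> of \<open>u\<close> mimic the transition of \<open>s\<close>. So \<open>t\<close> either walks to \<open>t'\<close> inside its
  class and mimics it there, or the transition is a \<open>\<tau>\<close>-step that stays in the class and \<open>t\<close> stops
  immediately.
\<close>

section \<open>Distributions and kernels of maps\<close>

lemma distr_equiv_kernel_iff:
  assumes R: "R = {(x, y). x \<in> S \<and> y \<in> S \<and> f x = f y}"
    and "\<mu> \<in> Distr S" "\<nu> \<in> Distr S"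
  shows "distr_equiv S R \<mu> \<nu> \<longleftrightarrow> map_pmf f \<mu> = map_pmf f \<nu>"
proof -
  have cls: "measure_pmf.prob \<rho> (R `` {x}) = pmf (map_pmf f \<rho>) (f x)"
    if "\<rho> \<in> Distr S" "x \<in> S" for \<rho> x
    unfolding pmf_map using that
    by (intro measure_pmf.finite_measure_eq_AE) (auto simp: AE_measure_pmf_iff R Distr_def)
  have out: "pmf (map_pmf f \<rho>) y = 0" if "\<rho> \<in> Distr S" "y \<notin> f ` S" for \<rho> y
    using that by (auto simp: pmf_eq_0_set_pmf Distr_def)
  show ?thesis
  proof
    assume eq: "distr_equiv S R \<mu> \<nu>"
    show "map_pmf f \<mu> = map_pmf f \<nu>"
    proof (rule pmf_eqI)
      fix y
      show "pmf (map_pmf f \<mu>) y = pmf (map_pmf f \<nu>) y"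
      proof (cases "y \<in> f ` S")
        case True
        then obtain x where x: "x \<in> S" "y = f x" by blast
        then have "measure_pmf.prob \<mu> (R `` {x}) = measure_pmf.prob \<nu> (R `` {x})"
          using eq by (auto simp: distr_equiv_def intro: quotientI)
        then show ?thesis using cls x assms(2,3) by simp
      qed (use out assms(2,3) in simp)
    qed
  next
    assume "map_pmf f \<mu> = map_pmf f \<nu>"
    then show "distr_equiv S R \<mu> \<nu>"
      using cls assms(2,3) by (auto simp: distr_equiv_def elim!: quotientE)
  qed
qed

lemma pmf_map_class:
  assumes "equiv S R" "\<mu> \<in> Distr S" "D \<in> S // R"
  shows "pmf (map_pmf (\<lambda>s. R `` {s}) \<mu>) D = measure_pmf.prob \<mu> D"
proof -
  have "R `` {s} = D \<longleftrightarrow> s \<in> D" if "s \<in> S" for s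
    using assms(1,3) that by (metis Image_singleton_iff equiv_class_eq_iff quotientE)
  then show ?thesis
    unfolding pmf_map using assms(2)
    by (intro measure_pmf.finite_measure_eq_AE) (auto simp: AE_measure_pmf_iff Distr_def)
qed

lemma map_class_in_Distr: "\<mu> \<in> Distr S \<Longrightarrow> map_pmf (\<lambda>s. R `` {s}) \<mu> \<in> Distr (S // R)"
  by (auto simp: Distr_def intro: quotientI)

text \<open>The class masses fix \<mu> on \<open>states A // R\<close>, and its support lies there,
  so \<mu> can only be the image of \<open>\<mu>'\<close> under the class map.\<close>

lemma quotient_transition_iff:
  assumes A: "prob_automaton \<tau> A" and R: "equiv (states A) R"
  shows "(C, a, \<mu>) \<in> transitions (quotient_pa A R) \<longleftrightarrow>
    (\<exists>s \<mu>'. (s, a, \<mu>') \<in> transitions A \<and> C = R `` {s} \<and> \<mu> = map_pmf (\<lambda>s. R `` {s}) \<mu>')"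
    (is "?l \<longleftrightarrow> ?r")
proof
  assume ?l
  then obtain s \<mu>' where C: "C \<in> states A // R" "s \<in> C" and \<mu>: "\<mu> \<in> Distr (states A // R)"
    and tr: "(s, a, \<mu>') \<in> transitions A"
    and eq: "\<forall>D \<in> states A // R. pmf \<mu> D = measure_pmf.prob \<mu>' D"
    by (auto simp: quotient_pa_def)
  have \<mu>': "\<mu>' \<in> Distr (states A)" using A tr by (auto simp: prob_automaton_def)
  have "C = R `` {s}"
    using C R by (metis Image_singleton_iff equiv_class_eq_iff quotientE)
  moreover have "\<mu> = map_pmf (\<lambda>s. R `` {s}) \<mu>'"
  proof (rule pmf_eqI)
    fix D
    show "pmf \<mu> D = pmf (map_pmf (\<lambda>s. R `` {s}) \<mu>') D"
    proof (cases "D \<in> states A // R")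
      case False
      then have "D \<notin> set_pmf \<mu>" "D \<notin> set_pmf (map_pmf (\<lambda>s. R `` {s}) \<mu>')"
        using \<mu> map_class_in_Distr[OF \<mu>', of R] unfolding Distr_def by blast+
      then show ?thesis by (metis pmf_eq_0_set_pmf)
    qed (simp add: eq pmf_map_class[OF R \<mu>'])
  qed
  ultimately show ?r using tr by blast
next
  assume ?r
  then obtain s \<mu>' where tr: "(s, a, \<mu>') \<in> transitions A" and C: "C = R `` {s}"
    and \<mu>: "\<mu> = map_pmf (\<lambda>s. R `` {s}) \<mu>'" by blast
  have \<mu>': "\<mu>' \<in> Distr (states A)" and s: "s \<in> states A" and a: "a \<in> actions A"
    using A tr by (auto simp: prob_automaton_def)
  have "s \<in> C" unfolding C using R s by (rule equiv_class_self)
  then show ?l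
    using tr a C s map_class_in_Distr[OF \<mu>'] pmf_map_class[OF R \<mu>']
    by (auto simp: quotient_pa_def \<mu> intro: quotientI)
qed

section \<open>Branching steps along a deterministic run\<close>

primrec path_length :: "('s, 'l) path \<Rightarrow> nat" where
  "path_length (Init s) = 0"
| "path_length (Step \<pi> a \<mu> t) = Suc (path_length \<pi>)"

primrec run_path :: "'l \<Rightarrow> (nat \<Rightarrow> 's) \<Rightarrow> nat \<Rightarrow> ('s, 'l) path" where
  "run_path \<tau> f 0 = Init (f 0)"
| "run_path \<tau> f (Suc k) = Step (run_path \<tau> f k) \<tau> (return_pmf (f (Suc k))) (f (Suc k))"

text \<open>The scheduler decides by the length of the path, since a run may revisit states.\<close>

definition run_scheduler ::
    "'l \<Rightarrow> (nat \<Rightarrow> 's) \<Rightarrow> nat \<Rightarrow> 'l \<Rightarrow> 's pmf \<Rightarrow> ('s, 'l) scheduler" where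
  "run_scheduler \<tau> f n a \<nu> \<pi> = return_pmf
     (if last_state \<pi> \<noteq> f (path_length \<pi>) then None
      else if path_length \<pi> < n then Some (last_state \<pi>, \<tau>, return_pmf (f (Suc (path_length \<pi>))))
      else if path_length \<pi> = n then Some (last_state \<pi>, a, \<nu>)
      else None)"

lemma last_state_run_path [simp]: "last_state (run_path \<tau> f k) = f k"
  by (cases k) auto

lemma first_state_run_path [simp]: "first_state (run_path \<tau> f k) = f 0"
  by (induction k) auto

lemma path_length_run_path [simp]: "path_length (run_path \<tau> f k) = k"
  by (induction k) auto

lemma path_prob_run_path:
  "k \<le> n \<Longrightarrow> path_prob (run_scheduler \<tau> f n a \<nu>) (run_path \<tau> f k) = 1"
  by (induction k) (auto simp: run_scheduler_def)

lemma scheduled_run_path: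
  "k \<le> n \<Longrightarrow> scheduled (run_scheduler \<tau> f n a \<nu>) (run_path \<tau> f k)"
  by (induction k) (auto simp: run_scheduler_def)

text \<open>Every decision is deterministic and the first \<open>n\<close> steps have Dirac targets,
  so scheduled paths can fork only at the final step into the support of \<nu>.\<close>

lemma scheduled_run_scheduler_cases:
  assumes "finite_path A \<pi>" "first_state \<pi> = f 0" "scheduled (run_scheduler \<tau> f n a \<nu>) \<pi>"
  shows "(\<exists>k\<le>n. \<pi> = run_path \<tau> f k) \<or> (\<exists>t \<in> set_pmf \<nu>. \<pi> = Step (run_path \<tau> f n) a \<nu> t)"
  using assms
proof (induction \<pi>)
  case (Init s)
  then show ?case by (intro disjI1 exI[of _ 0]) simp
next
  case (Step \<pi> b \<mu> t)
  then consider k where "k \<le> n" "\<pi> = run_path \<tau> f k"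
    | t' where "t' \<in> set_pmf \<nu>" "\<pi> = Step (run_path \<tau> f n) a \<nu> t'" by auto
  then show ?case
  proof cases
    case 1
    show ?thesis
    proof (cases "k < n")
      case True
      then have "b = \<tau>" "\<mu> = return_pmf (f (Suc k))"
        using Step.prems 1 by (auto simp: run_scheduler_def indicator_def split: if_splits)
      moreover have "t = f (Suc k)"
        using Step.prems calculation by (auto simp: indicator_def split: if_splits)
      ultimately show ?thesis using True 1 by (intro disjI1 exI[of _ "Suc k"]) simp
    next
      case False
      then show ?thesis
        using Step.prems 1
        by (auto simp: run_scheduler_def indicator_def set_pmf_iff split: if_splits)
    qed
  next
    case 2
    \<comment> \<open>A path with \<open>n + 1\<close> steps has no scheduled extension: at that
      length the scheduler always stops.\<close>
    then show ?thesis
      using Step.prems by (auto simp: run_scheduler_def indicator_def split: if_splits)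
  qed
qed

text \<open>Turns a walk inside a class followed by one transition into a branching step.
  \<open>rel\<close> covers \<open>f 1\<close> to \<open>f n\<close> only, since the target of the
  last step is unconstrained.\<close>

lemma branching_step_run:
  assumes s: "f 0 \<in> states A"
    and steps: "\<And>i. i < n \<Longrightarrow> (f i, \<tau>, return_pmf (f (Suc i))) \<in> transitions A"
    and rel: "\<And>i. i < n \<Longrightarrow> (f 0, f (Suc i)) \<in> R"
    and last: "(f n, a, \<nu>) \<in> transitions A"
  shows "branching_step \<tau> A R (f 0) a \<nu>"
proof -
  let ?S = "run_scheduler \<tau> f n a \<nu>"
  have fin: "finite_path A (run_path \<tau> f k)" if "k \<le> n" for k
    using that by (induction k) (auto simp: s intro: steps)
  have silent: "silent_within \<tau> R (f 0) (run_path \<tau> f k)" if "k \<le> n" for k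
    using that by (induction k) (auto intro: rel)
  have max: "maximal_paths A ?S (f 0) = Step (run_path \<tau> f n) a \<nu> ` set_pmf \<nu>" (is "?M = ?P")
  proof
    show "?M \<subseteq> ?P"
    proof
      fix \<pi> assume \<pi>: "\<pi> \<in> ?M"
      \<comment> \<open>Proper prefixes are not maximal: the scheduler never stops on the run
        itself.\<close>
      have "\<not> pmf (?S (run_path \<tau> f k)) None > 0" if "k \<le> n" for k
        using that by (auto simp: run_scheduler_def)
      then show "\<pi> \<in> ?P"
        using \<pi> scheduled_run_scheduler_cases[of A \<pi> f \<tau> n a \<nu>]
        by (auto simp: maximal_paths_def)
    qed
    have "\<And>t. t \<in> set_pmf \<nu> \<Longrightarrow> pmf \<nu> t > 0" by (simp add: pmf_positive)
    then show "?P \<subseteq> ?M"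
      using fin[of n] scheduled_run_path[of n n] last
      by (auto simp: maximal_paths_def) (auto simp: run_scheduler_def)
  qed
  have prob: "path_prob ?S (Step (run_path \<tau> f n) a \<nu> t) *
      pmf (?S (Step (run_path \<tau> f n) a \<nu> t)) None = pmf \<nu> t" for t
    using path_prob_run_path[of n n \<tau> f a \<nu>] by (simp add: run_scheduler_def[of _ _ _ _ _ "run_path _ _ _"]
      run_scheduler_def[of _ _ _ _ _ "Step _ _ _ _"])
  \<comment> \<open>Maximal paths differ only in their last state, so the sum for \<open>t\<close>
    has at most one term, which \<open>prob\<close> evaluates.\<close>
  have "final_distr A ?S (f 0) t = ennreal (pmf \<nu> t)" for t
  proof (cases "t \<in> set_pmf \<nu>")
    case True
    then have "{\<pi> \<in> maximal_paths A ?S (f 0). last_state \<pi> = t} = {Step (run_path \<tau> f n) a \<nu> t}"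
      by (auto simp: max)
    then show ?thesis
      unfolding final_distr_def
      by (simp only: infsum_finite finite.intros) (simp add: prob del: path_prob.simps)
  next
    case False
    then have "{\<pi> \<in> maximal_paths A ?S (f 0). last_state \<pi> = t} = {}"
      by (auto simp: max)
    then show ?thesis using False unfolding final_distr_def
      by (simp only: infsum_empty) (simp add: pmf_eq_0_set_pmf)
  qed
  \<comment> \<open>Legality is required on all finite paths. Off the run the scheduler stops; where
    it moves, the last state is \<open>f i\<close> with \<open>i \<le> n\<close>, whose transition
    is given.\<close>
  moreover have "is_scheduler A ?S"
    using steps last by (auto simp: is_scheduler_def run_scheduler_def)
  ultimately show ?thesis
    using silent[of n] max unfolding branching_step_def by blast
qed

lemma branching_step_single:
  assumes "s \<in> states A" "(s, a, \<nu>) \<in> transitions A"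
  shows "branching_step \<tau> A R s a \<nu>"
  using branching_step_run[of "\<lambda>_. s" A 0] assms by simp

section \<open>Confluent steps\<close>

text \<open>Links weak confluence, phrased with joins, to the quotient, formed by zigzags. Two
  descents to a common state form a zigzag; conversely, a single step \<open>s\<close> to
  \<open>t\<close> is joined at \<open>t\<close>, and the assumed transitivity and symmetry of joins
  absorb longer zigzags.\<close>

lemma conf_join_eq_conf_conv:
  assumes sub: "conf_step \<tau> c \<subseteq> states A \<times> states A"
    and equiv: "equiv (states A) (conf_join \<tau> A c)"
  shows "conf_join \<tau> A c = conf_conv \<tau> A c"
proof
  let ?r = "conf_step \<tau> c"
  have "(s, s') \<in> (?r \<union> ?r\<inverse>)\<^sup>*" if "(s, u) \<in> ?r\<^sup>*" "(s', u) \<in> ?r\<^sup>*" for s s' u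
  proof -
    have "(s, u) \<in> (?r \<union> ?r\<inverse>)\<^sup>*" using that(1) by (rule in_rtrancl_UnI[OF disjI1])
    moreover have "(u, s') \<in> (?r \<union> ?r\<inverse>)\<^sup>*"
      using that(2) by (intro in_rtrancl_UnI[OF disjI2]) (simp add: rtrancl_converseI)
    ultimately show ?thesis by (rule rtrancl_trans)
  qed
  then show "conf_join \<tau> A c \<subseteq> conf_conv \<tau> A c"
    by (auto simp: conf_join_def conf_conv_def conf_reach_def)
  have step: "(s, t) \<in> conf_join \<tau> A c" if "(s, t) \<in> ?r" for s t
    using that sub by (auto simp: conf_join_def conf_reach_def intro!: exI[of _ t])
  have "(s, t) \<in> conf_join \<tau> A c" if "(s, t) \<in> (?r \<union> ?r\<inverse>)\<^sup>*" "s \<in> states A" for s t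
    using that
  proof (induction rule: rtrancl_induct)
    case base
    then show ?case using equiv by (simp add: equiv_def refl_on_def)
  next
    case (step t u)
    then have "(t, u) \<in> conf_join \<tau> A c"
      using \<open>\<And>s t. (s, t) \<in> ?r \<Longrightarrow> (s, t) \<in> conf_join \<tau> A c\<close> equiv by (auto simp: equiv_def sym_def)
    then show ?case using step equiv by (meson equivE transD)
  qed
  then show "conf_conv \<tau> A c \<subseteq> conf_join \<tau> A c" by (auto simp: conf_conv_def)
qed

text \<open>The first case keeps an actual chain of confluent steps, which will become a run of a
  scheduler; in the second only the class of \<open>t'\<close> matters.\<close>

lemma weakly_confluent_simulates:
  assumes A: "prob_automaton \<tau> A" and wc: "weakly_confluent \<tau> A c"
    and st: "(s, t) \<in> conf_join \<tau> A c" and tr: "(s, a, \<mu>) \<in> transitions A"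
  shows "(\<exists>t' \<nu>. (t, t') \<in> (conf_step \<tau> c)\<^sup>* \<and> (t', a, \<nu>) \<in> transitions A \<and>
            distr_equiv (states A) (conf_join \<tau> A c) \<mu> \<nu>) \<or>
         a = \<tau> \<and> (\<exists>t' \<in> states A. (t, t') \<in> conf_join \<tau> A c \<and>
            distr_equiv (states A) (conf_join \<tau> A c) \<mu> (return_pmf t'))"
proof -
  obtain u where su: "(s, u) \<in> conf_reach \<tau> A c" and tu: "(t, u) \<in> conf_reach \<tau> A c"
    using st by (auto simp: conf_join_def)
  have "a \<in> actions A" "\<mu> \<in> Distr (states A)" using A tr by (auto simp: prob_automaton_def)
  then obtain t' where t': "t' \<in> states A" "(u, t') \<in> conf_reach \<tau> A c"
    and alt: "(\<exists>\<nu> \<in> Distr (states A). (t', a, \<nu>) \<in> transitions A \<and>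
               distr_equiv (states A) (conf_join \<tau> A c) \<mu> \<nu>) \<or>
           (a = \<tau> \<and> distr_equiv (states A) (conf_join \<tau> A c) \<mu> (return_pmf t'))"
    using wc su tr unfolding weakly_confluent_def by blast
  have tt': "(t, t') \<in> conf_reach \<tau> A c"
    using tu t' by (auto simp: conf_reach_def)
  then have "(t, t') \<in> conf_join \<tau> A c"
    using t' by (auto simp: conf_join_def conf_reach_def)
  then show ?thesis using alt tt' t' by (auto simp: conf_reach_def)
qed

section \<open>The bisimulation on the disjoint union\<close>

theorem theorem22:
  fixes A :: "('s, 'l) pa" and \<tau> :: 'l and c :: "('s \<times> 'l \<times> 's pmf) set"
  assumes "prob_automaton \<tau> A"
    and "c \<subseteq> {(s, a, \<mu>). (s, a, \<mu>) \<in> transitions A \<and> a = \<tau> \<and> (\<exists>t. \<mu> = return_pmf t)}"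
    and "weakly_confluent \<tau> A c"
  shows "bisimilar \<tau> (quotient_pa A (conf_conv \<tau> A c)) A"
proof -
  define R where "R = conf_conv \<tau> A c"
  define cls where "cls = (\<lambda>s. R `` {s})"
  define Q where "Q = quotient_pa A R"
  define B where "B = pa_sum Q A"
  \<comment> \<open>\<open>F\<close> maps each state of the sum to its class. Taking
    \<open>K\<close> as the kernel of \<open>F\<close> makes it an equivalence at once and lets
    distributions be compared by their images under \<open>F\<close>.\<close>
  define F where "F = case_sum id cls"
  define K where "K = {(x, y). x \<in> states B \<and> y \<in> states B \<and> F x = F y}"
  let ?S = "states A"
  have trA: "s \<in> ?S" "\<mu> \<in> Distr ?S" if "(s, a, \<mu>) \<in> transitions A" for s a \<mu>
    using assms(1) that by (auto simp: prob_automaton_def)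
  have cstep: "(s, \<tau>, return_pmf t) \<in> transitions A" if "(s, t) \<in> conf_step \<tau> c" for s t
    using that assms(2) by (auto simp: conf_step_def)
  then have sub: "conf_step \<tau> c \<subseteq> ?S \<times> ?S"
    using trA by (fastforce simp: Distr_def)
  have equiv: "equiv ?S (conf_join \<tau> A c)"
    using assms(3) by (simp add: weakly_confluent_def)
  then have join: "conf_join \<tau> A c = R"
    unfolding R_def by (rule conf_join_eq_conf_conv[OF sub])
  then have eqR: "equiv ?S R" using equiv by simp
  \<comment> \<open>\<open>R\<close> is also a kernel, that of \<open>cls\<close>, so
    \<open>distr_equiv_kernel_iff\<close> serves for both \<open>R\<close> and
    \<open>K\<close>.\<close>
  have R: "R = {(s, t). s \<in> ?S \<and> t \<in> ?S \<and> cls s = cls t}"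
    using equiv_class_eq_iff[OF eqR] by (auto simp: cls_def)
  have RD: "s \<in> ?S \<and> t \<in> ?S \<and> cls s = cls t" if "(s, t) \<in> R" for s t
    using that R by blast
  have F [simp]: "F (Inl C) = C" "F (Inr s) = cls s" for C s
    by (simp_all add: F_def)
  have statesB: "states B = (?S // R) <+> ?S"
    by (simp add: B_def pa_sum_def Q_def quotient_pa_def)
  have cls_in: "cls s \<in> ?S // R" if "s \<in> ?S" for s
    unfolding cls_def using that by (rule quotientI)
  have trQ: "(C, a, \<mu>) \<in> transitions Q \<longleftrightarrow>
      (\<exists>s \<mu>'. (s, a, \<mu>') \<in> transitions A \<and> C = cls s \<and> \<mu> = map_pmf cls \<mu>')" for C a \<mu>
    unfolding Q_def cls_def by (rule quotient_transition_iff[OF assms(1) eqR])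
  have trB_Inr: "(Inr s, a, map_pmf Inr \<mu>) \<in> transitions B" if "(s, a, \<mu>) \<in> transitions A" for s a \<mu>
    using that by (auto simp: B_def pa_sum_def)
  have trB_Inl: "(Inl (cls s), a, map_pmf Inl (map_pmf cls \<mu>)) \<in> transitions B"
    if "(s, a, \<mu>) \<in> transitions A" for s a \<mu>
    using that trQ[of "cls s" a "map_pmf cls \<mu>"] by (auto simp: B_def pa_sum_def)
  have F_map: "map_pmf F (map_pmf Inl \<nu>) = \<nu>" "map_pmf F (map_pmf Inr \<mu>) = map_pmf cls \<mu>" for \<nu> \<mu>
    by (simp_all add: pmf.map_comp comp_def)
  have distr_Inr: "map_pmf Inr \<mu> \<in> Distr (states B)" if "\<mu> \<in> Distr ?S" for \<mu>
    using that by (auto simp: Distr_def statesB)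
  have distr_Inl: "map_pmf Inl (map_pmf cls \<mu>) \<in> Distr (states B)" if "\<mu> \<in> Distr ?S" for \<mu>
    using that cls_in by (auto simp: Distr_def statesB)

  \<comment> \<open>A transition of either summand is traced to one of \<open>A\<close> with the
    same image on classes. If \<open>x\<close> is a class, \<open>s\<close> is some representative
    of it.\<close>
  have from_A: "\<exists>s \<mu>0. (s, a, \<mu>0) \<in> transitions A \<and> F x = cls s \<and> map_pmf F \<mu> = map_pmf cls \<mu>0 \<and>
      \<mu> \<in> Distr (states B)"
    if tr: "(x, a, \<mu>) \<in> transitions B" for x a \<mu>
  proof -
    consider C \<mu>1 where "x = Inl C" "\<mu> = map_pmf Inl \<mu>1" "(C, a, \<mu>1) \<in> transitions Q"
      | s \<mu>1 where "x = Inr s" "\<mu> = map_pmf Inr \<mu>1" "(s, a, \<mu>1) \<in> transitions A"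
      using tr by (auto simp: B_def pa_sum_def)
    then show ?thesis
    proof cases
      case 1
      then obtain s \<mu>0 where "(s, a, \<mu>0) \<in> transitions A" "C = cls s" "\<mu>1 = map_pmf cls \<mu>0"
        using trQ by blast
      with 1 show ?thesis using distr_Inl[OF trA(2)] F_map by (metis F(1))
    next
      case 2
      then show ?thesis using distr_Inr[OF trA(2)] F_map by (metis F(2))
    qed
  qed

  \<comment> \<open>The simulating state \<open>y\<close> enters through its class, so this and
    \<open>from_A\<close> settle all four combinations of summands.\<close>
  have simulate: "\<exists>\<mu>' \<in> Distr (states B). branching_step \<tau> B K y a \<mu>' \<and> map_pmf F \<mu>' = map_pmf cls \<mu>"
    if tr: "(s, a, \<mu>) \<in> transitions A" and y: "y \<in> states B" "F y = cls s" for s a \<mu> y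
  proof (cases y)
    case (Inl C)
    then have "branching_step \<tau> B K y a (map_pmf Inl (map_pmf cls \<mu>))"
      using trB_Inl[OF tr] y by (intro branching_step_single) auto
    then show ?thesis using distr_Inl[OF trA(2)[OF tr]] F_map by blast
  next
    case (Inr t)
    have t: "t \<in> ?S" "cls s = cls t" using y Inr by (auto simp: statesB)
    then have st: "(s, t) \<in> conf_join \<tau> A c" using trA(1)[OF tr] unfolding join by (subst R) auto
    have equivD: "map_pmf cls \<nu> = map_pmf cls \<mu>"
      if "distr_equiv ?S R \<mu> \<nu>" "\<nu> \<in> Distr ?S" for \<nu>
      using that distr_equiv_kernel_iff[OF R trA(2)[OF tr]] by metis
    consider (move) t' \<nu> where "(t, t') \<in> (conf_step \<tau> c)\<^sup>*" "(t', a, \<nu>) \<in> transitions A"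
        "distr_equiv ?S R \<mu> \<nu>"
      | (stay) t' where "a = \<tau>" "t' \<in> ?S" "(t, t') \<in> R" "distr_equiv ?S R \<mu> (return_pmf t')"
      using weakly_confluent_simulates[OF assms(1,3) st tr] unfolding join by blast
    then show ?thesis
    proof cases
      case move
      \<comment> \<open>The chain is indexed to serve as a run; \<open>n = 0\<close> means that
        \<open>t\<close> itself has the matching transition.\<close>
      then obtain n f where f: "f 0 = t" "f n = t'"
        and steps: "\<And>i. i < n \<Longrightarrow> (f i, f (Suc i)) \<in> conf_step \<tau> c"
        by (auto simp: rtrancl_power relpow_fun_conv)
      have in_R: "(f i, f (Suc i)) \<in> R" if "i < n" for i
        using steps[OF that] sub unfolding join[symmetric]
        by (auto simp: conf_join_def conf_reach_def intro!: exI[of _ "f (Suc i)"])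
      have run: "f i \<in> ?S \<and> cls (f i) = cls t" if "i \<le> n" for i
        using that
      proof (induction i)
        case (Suc i)
        then show ?case using RD[OF in_R[of i]] by simp
      qed (simp add: f t)
      have "(Inr (f 0), Inr (f (Suc i))) \<in> K" if "i < n" for i
        using run[of "Suc i"] that t f(1) by (simp add: K_def statesB InrI)
      moreover have "(Inr (f i), \<tau>, return_pmf (Inr (f (Suc i)))) \<in> transitions B" if "i < n" for i
        using trB_Inr[OF cstep[OF steps[OF that]]] by simp
      moreover have "(Inr (f n), a, map_pmf Inr \<nu>) \<in> transitions B"
        using trB_Inr move f by simp
      ultimately have "branching_step \<tau> B K y a (map_pmf Inr \<nu>)"
        using branching_step_run[of "\<lambda>i. Inr (f i)" B n \<tau> K a "map_pmf Inr \<nu>"] y Inr f by simp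
      then show ?thesis
        using distr_Inr equivD[OF move(3)] trA(2)[OF move(2)] F_map by metis
    next
      case stay
      \<comment> \<open>Weak confluence offers the Dirac distribution at \<open>t'\<close>, while
        the empty branching step ends at \<open>y\<close>; both have the same image because
        \<open>t\<close> and \<open>t'\<close> share a class.\<close>
      have "cls t' = cls t" using RD[OF stay(3)] by simp
      then have "map_pmf F (return_pmf y) = map_pmf cls \<mu>"
        using equivD[OF stay(4)] stay(2) Inr by (simp add: Distr_def)
      moreover have "branching_step \<tau> B K y a (return_pmf y)"
        using stay(1) by (simp add: branching_step_def)
      moreover have "return_pmf y \<in> Distr (states B)" using y by (simp add: Distr_def)
      ultimately show ?thesis by blast
    qed
  qed

  have "branching_bisimulation \<tau> B K"
    unfolding branching_bisimulation_def
  proof (intro conjI ballI, goal_cases)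
    case 1
    show ?case by (auto simp: K_def equiv_def refl_on_def sym_def trans_def)
  next
    case (2 xy)
    have "\<exists>\<mu>' \<in> Distr (states B). branching_step \<tau> B K y a \<mu>' \<and> distr_equiv (states B) K \<mu> \<mu>'"
      if xy: "(x, y) \<in> K" and tr: "(x, a, \<mu>) \<in> transitions B" for x y a \<mu>
    proof -
      obtain s \<mu>0 where s: "(s, a, \<mu>0) \<in> transitions A" "F x = cls s"
        "map_pmf F \<mu> = map_pmf cls \<mu>0" "\<mu> \<in> Distr (states B)"
        using from_A[OF tr] by blast
      moreover have "y \<in> states B" "F y = cls s" using xy s by (auto simp: K_def)
      ultimately obtain \<mu>' where "\<mu>' \<in> Distr (states B)" "branching_step \<tau> B K y a \<mu>'"
        "map_pmf F \<mu>' = map_pmf F \<mu>"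
        using simulate[of s a \<mu>0 y] by metis
      then show ?thesis using distr_equiv_kernel_iff[OF K_def s(4)] by metis
    qed
    then show ?case using 2 by blast
  qed
  moreover have "(Inl (init Q), Inr (init A)) \<in> K"
    using assms(1) cls_in
    by (auto simp: K_def statesB Q_def quotient_pa_def cls_def prob_automaton_def)
  ultimately show ?thesis
    unfolding bisimilar_def bisimilar_states_def B_def Q_def R_def by blast
qed

end
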